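(* Let $n\ge 1$ and let $G$ be a connected graph on $n$ vertices. Let $K_n$ be the complete graph on $n$ vertices. Then $G\geq_e K_n$ if and only if $X_G$ is $e$-positive.
   Context: All graphs are finite and simple. The chromatic symmetric function of a graph $G$ with vertices $v_1,\dots,v_n$ is $X_G=\sum_{\kappa}x_{\kappa(v_1)}\cdots x_{\kappa(v_n)}$, summed over all proper colorings $\kappa:V(G)\to\{1,2,3,\dots\}$ (adjacent vertices get different colors); it is a homogeneous symmetric function of degree $n$ in commuting variables $x_1,x_2,\dots$ over $\mathbb{Q}$. Let $e_i$ be the $i$-th elementary symmetric function and $e_\lambda=e_{\lambda_1}e_{\lambda_2}\cdots$ for an integer partition $\lambda$; $\{e_\lambda:\lambda\vdash n\}$ is a basis of the degree-$n$ symmetric functions. $[e_\lambda]F$ denotes the coefficient of $e_\lambda$ in $F$, and $F$ is $e$-positive if $[e_\lambda]F\ge 0$ for all $\lambda$. For connected graphs $G,H$ on $n$ vertices (for which $[e_{(n)}]X_G$ and $[e_{(n)}]X_H$ are positive), set $$X_e(G,H)=X_G-\frac{[e_{(n)}]X_G}{[e_{(n)}]X_H}X_H,$$ and write $G\geq_e H$ if $X_e(G,H)$ is $e$-positive. *)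

theory Defs
  imports Complex_Main "HOL-Library.Multiset" "HOL-Library.FuncSet" "Graph_Theory.Graph_Theory"
begin

section \<open>Power series over the rationals in countably many variables\<close>

text \<open>
  A monomial is the finite multiset of the indices of its variables. Indices start at 0:
  index \<open>i\<close> stands for the variable $x_{i+1}$. Symmetric functions are elements of this ring.
\<close>

typedef mpower_series = "UNIV :: (nat multiset \<Rightarrow> rat) set"
  morphisms mcoeff Abs_mpower_series ..

setup_lifting type_definition_mpower_series

lemma mpower_series_eqI: "(\<And>m. mcoeff F m = mcoeff H m) \<Longrightarrow> F = H"
  by transfer auto

lemma finite_submultisets: "finite {a :: 'a multiset. a \<subseteq># m}"
proof (induction m)
  case (add x m)
  have "{a. a \<subseteq># add_mset x m} \<subseteq> {a. a \<subseteq># m} \<union> add_mset x ` {a. a \<subseteq># m}"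
  proof
    fix a assume a: "a \<in> {a. a \<subseteq># add_mset x m}"
    show "a \<in> {a. a \<subseteq># m} \<union> add_mset x ` {a. a \<subseteq># m}"
    proof (cases "x \<in># a")
      case True
      then obtain b where "a = add_mset x b" by (meson mset_add)
      with a show ?thesis by auto
    next
      case False
      with a have "count a y \<le> count m y" for y
        using mset_subset_eq_count [of a "add_mset x m" y]
        by (cases "y = x") (auto simp: not_in_iff)
      then have "a \<subseteq># m" by (simp add: subseteq_mset_def)
      then show ?thesis by auto
    qed
  qed
  with add show ?case by (meson finite_UnI finite_imageI finite_subset)
qed auto

lemma finite_splittings: "finite {(a, b :: 'a multiset). a + b = m}"
proof (rule finite_subset)
  show "{(a, b). a + b = m} \<subseteq> {a. a \<subseteq># m} \<times> {b. b \<subseteq># m}" by auto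
  show "finite ({a. a \<subseteq># m} \<times> {b. b \<subseteq># m})" by (simp add: finite_submultisets)
qed

instantiation mpower_series :: comm_ring_1
begin

lift_definition zero_mpower_series :: mpower_series is "\<lambda>m. 0" .

lift_definition one_mpower_series :: mpower_series is "\<lambda>m. if m = {#} then 1 else 0" .

lift_definition plus_mpower_series :: "mpower_series \<Rightarrow> mpower_series \<Rightarrow> mpower_series"
  is "\<lambda>F H m. F m + H m" .

lift_definition minus_mpower_series :: "mpower_series \<Rightarrow> mpower_series \<Rightarrow> mpower_series"
  is "\<lambda>F H m. F m - H m" .

lift_definition uminus_mpower_series :: "mpower_series \<Rightarrow> mpower_series"
  is "\<lambda>F m. - F m" .

lift_definition times_mpower_series :: "mpower_series \<Rightarrow> mpower_series \<Rightarrow> mpower_series"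
  is "\<lambda>F H m. \<Sum>(a, b) | a + b = m. F a * H b" .

instance
proof
  fix F H L :: mpower_series
  show "F * H * L = F * (H * L)"
  proof transfer
    fix F H L :: "nat multiset \<Rightarrow> rat"
    show "(\<lambda>m. \<Sum>(d, c) | d + c = m. (\<Sum>(a, b) | a + b = d. F a * H b) * L c)
        = (\<lambda>m. \<Sum>(a, d) | a + d = m. F a * (\<Sum>(b, c) | b + c = d. H b * L c))"
    proof
      fix m
      let ?S = "\<lambda>m :: nat multiset. {(a, b). a + b = m}"
      have "(\<Sum>(d, c) \<in> ?S m. (\<Sum>(a, b) \<in> ?S d. F a * H b) * L c)
          = (\<Sum>(p, q) \<in> Sigma (?S m) (\<lambda>p. ?S (fst p)). F (fst q) * H (snd q) * L (snd p))"
        by (subst sum.Sigma [symmetric])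
          (auto simp: finite_splittings sum_distrib_right case_prod_beta intro!: sum.cong)
      also have "\<dots> = (\<Sum>(p, q) \<in> Sigma (?S m) (\<lambda>p. ?S (snd p)). F (fst p) * (H (fst q) * L (snd q)))"
        by (rule sum.reindex_bij_witness [where
              i = "\<lambda>((a, d), (b, c)). ((a + b, c), (a, b))" and
              j = "\<lambda>((d, c), (a, b)). ((a, b + c), (b, c))"])
          (auto simp: algebra_simps)
      also have "\<dots> = (\<Sum>(a, d) \<in> ?S m. F a * (\<Sum>(b, c) \<in> ?S d. H b * L c))"
        by (subst sum.Sigma [symmetric])
          (auto simp: finite_splittings sum_distrib_left case_prod_beta intro!: sum.cong)
      finally show "(\<Sum>(d, c) \<in> ?S m. (\<Sum>(a, b) \<in> ?S d. F a * H b) * L c)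
          = (\<Sum>(a, d) \<in> ?S m. F a * (\<Sum>(b, c) \<in> ?S d. H b * L c))" .
    qed
  qed
  show "F * H = H * F"
  proof transfer
    fix F H :: "nat multiset \<Rightarrow> rat"
    show "(\<lambda>m. \<Sum>(a, b) | a + b = m. F a * H b) = (\<lambda>m. \<Sum>(a, b) | a + b = m. H a * F b)"
    proof
      fix m
      show "(\<Sum>(a, b) | a + b = m. F a * H b) = (\<Sum>(a, b) | a + b = m. H a * F b)"
        by (rule sum.reindex_bij_witness [where i = prod.swap and j = prod.swap])
          (auto simp: add.commute)
    qed
  qed
  show "1 * F = F"
  proof transfer
    fix F :: "nat multiset \<Rightarrow> rat"
    show "(\<lambda>m. \<Sum>(a, b) | a + b = m. (if a = {#} then 1 else 0) * F b) = F"
    proof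
      fix m
      have "(\<Sum>(a, b) | a + b = m. (if a = {#} then 1 else 0) * F b)
          = (\<Sum>(a, b) \<in> {({#} :: nat multiset, m)}. (if a = {#} then 1 else 0) * F b)"
        by (rule sum.mono_neutral_right) (auto simp: finite_splittings split: if_splits)
      then show "(\<Sum>(a, b) | a + b = m. (if a = {#} then 1 else 0) * F b) = F m" by simp
    qed
  qed
  show "(F + H) * L = F * L + H * L"
    by transfer (auto simp: fun_eq_iff distrib_right case_prod_beta sum.distrib)
  show "(0 :: mpower_series) \<noteq> 1"
    by transfer (auto simp: fun_eq_iff)
qed (transfer; auto simp: fun_eq_iff)+

end

lift_definition mscale :: "rat \<Rightarrow> mpower_series \<Rightarrow> mpower_series"
  is "\<lambda>c F m. c * F m" .


section \<open>Elementary symmetric functions\<close>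

lift_definition elem_sym :: "nat \<Rightarrow> mpower_series"
  is "\<lambda>k m. if \<exists>S. finite S \<and> card S = k \<and> m = mset_set S then 1 else 0" .

text \<open>An integer partition is represented by the finite multiset of its (positive) parts.\<close>

definition int_partition :: "nat multiset \<Rightarrow> bool" where
  "int_partition lam \<longleftrightarrow> 0 \<notin># lam"

definition elem_sym_part :: "nat multiset \<Rightarrow> mpower_series" where
  "elem_sym_part lam = (\<Prod>i\<in>#lam. elem_sym i)"

definition is_e_expansion :: "(nat multiset \<Rightarrow> rat) \<Rightarrow> mpower_series \<Rightarrow> bool" where
  "is_e_expansion c F \<longleftrightarrow>
     finite {lam. c lam \<noteq> 0} \<and>
     (\<forall>lam. c lam \<noteq> 0 \<longrightarrow> int_partition lam) \<and>
     F = (\<Sum>lam | c lam \<noteq> 0. mscale (c lam) (elem_sym_part lam))"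

text \<open>
  The $e_\lambda$ form a basis of the symmetric functions, so for symmetric \<open>F\<close> of bounded degree
  the expansion exists and is unique; the coefficient is meaningful for such \<open>F\<close> only.
\<close>

definition e_coeff :: "nat multiset \<Rightarrow> mpower_series \<Rightarrow> rat" where
  "e_coeff lam F = (THE c. is_e_expansion c F) lam"

definition e_positive :: "mpower_series \<Rightarrow> bool" where
  "e_positive F \<longleftrightarrow> (\<forall>lam. int_partition lam \<longrightarrow> e_coeff lam F \<ge> 0)"


section \<open>Chromatic symmetric functions\<close>

text \<open>
  Finite simple graphs are those of the locale \<open>graph\<close>: symmetric digraphs without loops and
  parallel arcs. Colors are numbered from 0, as are the variables.
\<close>

definition proper_colorings :: "('a, 'b) pre_digraph \<Rightarrow> ('a \<Rightarrow> nat) set" where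
  "proper_colorings G =
     {\<kappa> \<in> verts G \<rightarrow>\<^sub>E UNIV. \<forall>u v. u \<rightarrow>\<^bsub>G\<^esub> v \<longrightarrow> \<kappa> u \<noteq> \<kappa> v}"

text \<open>
  The coloring \<open>\<kappa>\<close> contributes the monomial given by the multiset of the colors of all vertices.
  So the coefficient of \<open>m\<close> in the sum over all proper colorings is the number of those whose
  monomial is \<open>m\<close>; there are finitely many, as they take values in the support of \<open>m\<close>.
\<close>

definition chromatic_sym :: "('a, 'b) pre_digraph \<Rightarrow> mpower_series" where
  "chromatic_sym G = Abs_mpower_series (\<lambda>m.
     of_nat (card {\<kappa> \<in> proper_colorings G. image_mset \<kappa> (mset_set (verts G)) = m}))"

text \<open>Intended for connected graphs \<open>G\<close> and \<open>H\<close> with the same number of vertices.\<close>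

definition X_e :: "('a, 'b) pre_digraph \<Rightarrow> ('c, 'd) pre_digraph \<Rightarrow> mpower_series" where
  "X_e G H =
     (let n = card (verts G) in
      chromatic_sym G
      - mscale (e_coeff {#n#} (chromatic_sym G) / e_coeff {#n#} (chromatic_sym H)) (chromatic_sym H))"

definition geq_e :: "('a, 'b) pre_digraph \<Rightarrow> ('c, 'd) pre_digraph \<Rightarrow> bool" (infix \<open>\<ge>\<^sub>e\<close> 50) where
  "G \<ge>\<^sub>e H \<longleftrightarrow> e_positive (X_e G H)"

end

theory Submission
  imports Defs "HOL-Library.Multiset_Order" "HOL-Computational_Algebra.Polynomial"
begin

text \<open>
  Since $X_{K_n} = n!\, e_n$, the series $X_e(G, K_n)$ arises from $X_G$ by deleting its $e_n$ term,
  so the point is that $[e_n] X_G \geq 0$. Setting $q$ variables to 1 and the others to 0 turns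
  $X_G$ into the chromatic polynomial $\chi_G(q)$ and $e_\lambda$ into
  $\prod_i \binom{q}{\lambda_i}$, which is divisible by $q^2$ if $\lambda$ has at least two
  parts. Comparing linear coefficients, $[e_n] X_G$ is $(-1)^{n-1} n$ times the linear coefficient
  of $\chi_G$, whose sign follows by deletion and contraction.
\<close>

section \<open>Uniqueness of the elementary expansion\<close>

lemma mcoeff_minus: "mcoeff (F - H) m = mcoeff F m - mcoeff H m"
  by transfer simp

lemma mcoeff_mscale: "mcoeff (mscale c F) m = c * mcoeff F m"
  by transfer simp

lemma mcoeff_one: "mcoeff 1 m = (if m = {#} then 1 else 0)"
  by transfer simp

lemma mcoeff_sum: "mcoeff (sum f A) m = (\<Sum>x\<in>A. mcoeff (f x) m)"
proof (induction A rule: infinite_finite_induct)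
  case (insert x A)
  then show ?case by (simp add: plus_mpower_series.rep_eq)
qed (simp_all add: zero_mpower_series.rep_eq)

lemma mcoeff_times:
  "mcoeff (F * H) m = (\<Sum>p\<in>{(a, b). a + b = m}. mcoeff F (fst p) * mcoeff H (snd p))"
  by (simp add: times_mpower_series.rep_eq case_prod_beta)

lemma mcoeff_elem_sym:
  "mcoeff (elem_sym k) m = (if \<exists>S. finite S \<and> card S = k \<and> m = mset_set S then 1 else 0)"
  by (simp add: elem_sym.rep_eq)

lemma elem_sym_part_add_mset:
  "elem_sym_part (add_mset k lam) = elem_sym k * elem_sym_part lam"
  by (simp add: elem_sym_part_def)

text \<open>Terms outside the support vanish, so the sum may run over any finite superset
  \<open>A\<close>. This lets two expansions be compared coefficientwise over a common index
  set.\<close>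

lemma is_e_expansion_iff:
  assumes "finite A" and "{lam. c lam \<noteq> 0} \<subseteq> A"
  shows "is_e_expansion c F \<longleftrightarrow>
    (\<forall>lam. c lam \<noteq> 0 \<longrightarrow> int_partition lam) \<and>
    (\<forall>m. mcoeff F m = (\<Sum>lam\<in>A. c lam * mcoeff (elem_sym_part lam) m))"
proof -
  have fin: "finite {lam. c lam \<noteq> 0}"
    using assms finite_subset by blast
  have "(\<Sum>lam\<in>A. c lam * mcoeff (elem_sym_part lam) m)
      = mcoeff (\<Sum>lam | c lam \<noteq> 0. mscale (c lam) (elem_sym_part lam)) m" for m
    unfolding mcoeff_sum mcoeff_mscale
    by (rule sum.mono_neutral_right) (use assms in auto)
  then show ?thesis
    using fin by (auto simp: is_e_expansion_def intro: mpower_series_eqI)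
qed

text \<open>
  Least in the multiset order, which compares the exponents of the variables of largest index first.
\<close>

definition least_monomial :: "nat multiset \<Rightarrow> nat multiset" where
  "least_monomial lam = (\<Sum>k\<in>#lam. mset_set {..<k})"

lemma least_monomial_add_mset:
  "least_monomial (add_mset k lam) = mset_set {..<k} + least_monomial lam"
  by (simp add: least_monomial_def)

text \<open>The exponents are the parts of the conjugate partition: each part \<open>k\<close> uses
  every variable of index below \<open>k\<close> once.\<close>

lemma count_least_monomial: "count (least_monomial lam) i = size {#k \<in># lam. i < k#}"
  by (induction lam) (auto simp: least_monomial_def count_mset_set')

text \<open>A partition is recovered from its conjugate: the multiplicity of the part
  \<open>Suc i\<close> is the drop between the exponents at \<open>i\<close> and
  \<open>Suc i\<close>. Parts equal to 0 leave no trace in the monomial, hence the restriction to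
  integer partitions.\<close>

lemma least_monomial_inj:
  assumes "int_partition lam" "int_partition mu" "least_monomial lam = least_monomial mu"
  shows "lam = mu"
proof (rule multiset_eqI)
  fix k
  have size_eq: "size {#k \<in># lam. i < k#} = size {#k \<in># mu. i < k#}" for i
    using assms(3) by (metis count_least_monomial)
  have split: "size {#k \<in># nu. i < k#} = count nu (Suc i) + size {#k \<in># nu. Suc i < k#}" for nu i
    by (induction nu) auto
  show "count lam k = count mu k"
  proof (cases k)
    case 0
    with assms(1,2) show ?thesis by (simp add: int_partition_def not_in_iff)
  next
    case (Suc i)
    with size_eq[of i] size_eq[of "Suc i"] split[of i lam] split[of i mu] show ?thesis by simp
  qed
qed

lemma mset_set_lessThan_le:
  assumes "finite S"
  shows "mset_set {..<card S} \<le> mset_set S"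
  unfolding less_eq_multiset\<^sub>H\<^sub>O
proof (intro allI impI)
  fix y assume "count (mset_set S) y < count (mset_set {..<card S}) y"
  then have y: "y < card S" "y \<notin> S"
    using assms by (auto simp: count_mset_set' split: if_splits)
  \<comment> \<open>Otherwise \<open>S\<close> would be all of \<open>{..<card S}\<close> and
    contain \<open>y\<close>. An index of at least \<open>card S\<close> in \<open>S\<close> then
    outweighs the missing \<open>y\<close>.\<close>
  have "\<not> S \<subseteq> {..<card S}"
    using y card_subset_eq[of "{..<card S}" S] by auto
  then obtain x where "x \<in> S" "card S \<le> x"
    by (meson lessThan_iff not_less subsetI)
  then show "\<exists>x>y. count (mset_set {..<card S}) x < count (mset_set S) x"
    using y assms by (intro exI[of _ x]) auto
qed

lemma least_monomial_elem_sym: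
  assumes "mcoeff (elem_sym k) m \<noteq> 0"
  shows "mset_set {..<k} \<le> m"
  using assms mset_set_lessThan_le by (auto simp: mcoeff_elem_sym split: if_splits)

text \<open>Each monomial of a product is a sum of monomials of the factors, and the multiset order
  is compatible with addition, so the lower bounds add up.\<close>

lemma least_monomial_le:
  assumes "mcoeff (elem_sym_part lam) m \<noteq> 0"
  shows "least_monomial lam \<le> m"
  using assms
proof (induction lam arbitrary: m)
  case empty
  then show ?case by (simp add: least_monomial_def)
next
  case (add k lam)
  then obtain p where "p \<in> {(a, b). a + b = m}"
    and "mcoeff (elem_sym k) (fst p) * mcoeff (elem_sym_part lam) (snd p) \<noteq> 0"
    unfolding elem_sym_part_add_mset mcoeff_times by (meson sum.neutral)
  then show ?case
    using add.IH least_monomial_elem_sym by (auto simp: least_monomial_add_mset intro!: add_mono)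
qed

text \<open>A sum of two lower bounds is attained only if both are, so a single splitting of the
  least monomial contributes.\<close>

lemma mcoeff_least_monomial: "mcoeff (elem_sym_part lam) (least_monomial lam) = 1"
proof (induction lam)
  case empty
  then show ?case by (simp add: least_monomial_def elem_sym_part_def mcoeff_one)
next
  case (add k lam)
  let ?m = "least_monomial (add_mset k lam)"
  let ?f = "\<lambda>p. mcoeff (elem_sym k) (fst p) * mcoeff (elem_sym_part lam) (snd p)"
  have "mcoeff (elem_sym_part (add_mset k lam)) ?m = sum ?f {(a, b). a + b = ?m}"
    by (simp only: elem_sym_part_add_mset mcoeff_times)
  also have "\<dots> = sum ?f {(mset_set {..<k}, least_monomial lam)}"
  proof (rule sum.mono_neutral_right)
    show "\<forall>p \<in> {(a, b). a + b = ?m} - {(mset_set {..<k}, least_monomial lam)}. ?f p = 0"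
    proof (rule ballI, rule ccontr)
      fix p assume p: "p \<in> {(a, b). a + b = ?m} - {(mset_set {..<k}, least_monomial lam)}"
        and nz: "?f p \<noteq> 0"
      obtain a b where ab: "p = (a, b)" by force
      have le: "mset_set {..<k} \<le> a" "least_monomial lam \<le> b"
        using nz ab least_monomial_elem_sym least_monomial_le by auto
      have eq: "a + b = mset_set {..<k} + least_monomial lam"
        using p ab by (simp add: least_monomial_add_mset)
      have "a = mset_set {..<k}"
        using le eq by (metis add_less_le_mono less_irrefl order_le_less)
      with eq p ab show False by auto
    qed
  qed (auto simp: finite_splittings least_monomial_add_mset)
  also have "\<dots> = 1"
    using add.IH by (auto simp: mcoeff_elem_sym intro!: exI[of _ "{..<k}"])
  finally show ?case .
qed

text \<open>Triangularity: among the partitions where \<open>c\<close> and \<open>d\<close> differ,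
  one with the smallest least monomial is alone in contributing to that monomial in the difference
  of the expansions.\<close>

lemma is_e_expansion_unique:
  assumes "is_e_expansion c F" "is_e_expansion d F"
  shows "c = d"
proof (rule ccontr)
  assume "c \<noteq> d"
  define A where "A = {lam. c lam \<noteq> 0} \<union> {lam. d lam \<noteq> 0}"
  define B where "B = {lam. c lam \<noteq> d lam}"
  have "finite A" using assms by (simp add: A_def is_e_expansion_def)
  have "B \<subseteq> A" by (auto simp: A_def B_def)
  have part: "int_partition lam" if "lam \<in> A" for lam
    using that assms by (auto simp: A_def is_e_expansion_def)
  have cF: "mcoeff F m = (\<Sum>lam\<in>A. c lam * mcoeff (elem_sym_part lam) m)"
    and dF: "mcoeff F m = (\<Sum>lam\<in>A. d lam * mcoeff (elem_sym_part lam) m)" for m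
    using assms is_e_expansion_iff[OF \<open>finite A\<close>] by (auto simp: A_def)
  have "finite B" "B \<noteq> {}"
    using \<open>B \<subseteq> A\<close> \<open>finite A\<close> finite_subset \<open>c \<noteq> d\<close> by (auto simp: B_def)
  then obtain lam where lam: "lam \<in> B" "\<And>mu. mu \<in> B \<Longrightarrow> least_monomial lam \<le> least_monomial mu"
    by (metis (no_types, lifting) arg_min_if_finite(1) arg_min_least)
  let ?m = "least_monomial lam"
  have "0 = (\<Sum>mu\<in>A. (c mu - d mu) * mcoeff (elem_sym_part mu) ?m)"
    using cF[of ?m] dF[of ?m] by (simp add: left_diff_distrib sum_subtractf)
  also have "\<dots> = (\<Sum>mu\<in>{lam}. (c mu - d mu) * mcoeff (elem_sym_part mu) ?m)"
  proof (rule sum.mono_neutral_right[OF \<open>finite A\<close>])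
    show "\<forall>mu\<in>A - {lam}. (c mu - d mu) * mcoeff (elem_sym_part mu) ?m = 0"
    proof (rule ballI, rule ccontr)
      fix mu assume mu: "mu \<in> A - {lam}" and nz: "(c mu - d mu) * mcoeff (elem_sym_part mu) ?m \<noteq> 0"
      \<comment> \<open>The nonzero factor \<open>c mu - d mu\<close> puts \<open>mu\<close> in
        \<open>B\<close>, so the choice of \<open>lam\<close> gives one inequality; the nonzero
        coefficient of \<open>?m\<close> gives the other.\<close>
      then have "least_monomial mu = ?m"
        using lam(2)[of mu] least_monomial_le[of mu ?m] by (auto simp: B_def)
      with mu lam(1) \<open>B \<subseteq> A\<close> part least_monomial_inj show False by blast
    qed
  qed (use lam(1) \<open>B \<subseteq> A\<close> in auto)
  also have "\<dots> = c lam - d lam"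
    by (simp add: mcoeff_least_monomial)
  finally show False using lam(1) by (simp add: B_def)
qed

text \<open>Uniqueness resolves the definite description, so a coefficient can be read off from any
  exhibited expansion.\<close>

lemma e_coeff_eqI: "is_e_expansion c F \<Longrightarrow> e_coeff lam F = c lam"
  unfolding e_coeff_def by (metis is_e_expansion_unique the_equality)

lemma is_e_expansion_diff:
  assumes "is_e_expansion c F" "int_partition lam"
  shows "is_e_expansion (c(lam := c lam - d)) (F - mscale d (elem_sym_part lam))"
proof -
  \<comment> \<open>\<open>lam\<close> is inserted because \<open>c lam\<close> may be 0 while the
    new coefficient is not.\<close>
  define A where "A = insert lam {mu. c mu \<noteq> 0}"
  have fin: "finite A" using assms by (simp add: A_def is_e_expansion_def)
  have "(\<Sum>mu\<in>A. (c(lam := c lam - d)) mu * mcoeff (elem_sym_part mu) m)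
      = (\<Sum>mu\<in>A. c mu * mcoeff (elem_sym_part mu) m
          - (if mu = lam then d * mcoeff (elem_sym_part lam) m else 0))" for m
    by (rule sum.cong) (auto simp: algebra_simps)
  then have "(\<Sum>mu\<in>A. (c(lam := c lam - d)) mu * mcoeff (elem_sym_part mu) m)
      = (\<Sum>mu\<in>A. c mu * mcoeff (elem_sym_part mu) m) - d * mcoeff (elem_sym_part lam) m" for m
    using fin by (simp add: sum_subtractf A_def)
  moreover have "mcoeff F m = (\<Sum>mu\<in>A. c mu * mcoeff (elem_sym_part mu) m)" for m
    using assms(1) is_e_expansion_iff[OF fin, of c] by (auto simp: A_def)
  ultimately show ?thesis
    using assms fin
    by (subst is_e_expansion_iff[OF fin])
      (auto simp: A_def is_e_expansion_def mcoeff_minus mcoeff_mscale)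
qed


section \<open>Chromatic polynomials\<close>

text \<open>An arbitrary relation, possibly with loops and one-way pairs, keeps the class closed
  under deleting a single pair and under contraction.\<close>

definition relation_colorings :: "'a set \<Rightarrow> ('a \<times> 'a) set \<Rightarrow> 'c set \<Rightarrow> ('a \<Rightarrow> 'c) set" where
  "relation_colorings V E C = {\<kappa> \<in> V \<rightarrow>\<^sub>E C. \<forall>(u, v)\<in>E. \<kappa> u \<noteq> \<kappa> v}"

lemma finite_relation_colorings:
  "finite V \<Longrightarrow> finite C \<Longrightarrow> finite (relation_colorings V E C)"
  by (simp add: relation_colorings_def finite_PiE)

text \<open>Colorings with different colors at \<open>u\<close> and \<open>v\<close> are those of
  the relation with the extra pair; colorings with equal colors there are those of the relation with
  \<open>v\<close> merged into \<open>u\<close>.\<close>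

lemma card_relation_colorings_contract:
  assumes "finite V" "finite C" "E \<subseteq> V \<times> V" "u \<in> V" "v \<in> V" "u \<noteq> v"
  shows "card (relation_colorings V E C)
    = card (relation_colorings V (insert (u, v) E) C)
      + card (relation_colorings (V - {v}) (map_prod (id(v := u)) (id(v := u)) ` E) C)"
proof -
  let ?f = "id(v := u)"
  let ?E = "map_prod ?f ?f ` E"
  let ?S = "{\<kappa> \<in> relation_colorings V E C. \<kappa> u = \<kappa> v}"
  have "bij_betw (\<lambda>\<kappa>. restrict \<kappa> (V - {v})) ?S (relation_colorings (V - {v}) ?E C)"
  proof (rule bij_betw_byWitness[where f' = "\<lambda>\<kappa>. \<kappa>(v := \<kappa> u)"])
    show "\<forall>\<kappa>\<in>?S. (restrict \<kappa> (V - {v}))(v := restrict \<kappa> (V - {v}) u) = \<kappa>"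
      using assms by (auto simp: relation_colorings_def PiE_def extensional_def fun_eq_iff)
    show "\<forall>\<kappa>\<in>relation_colorings (V - {v}) ?E C. restrict (\<kappa>(v := \<kappa> u)) (V - {v}) = \<kappa>"
      by (auto simp: relation_colorings_def PiE_def extensional_def fun_eq_iff)
    show "(\<lambda>\<kappa>. restrict \<kappa> (V - {v})) ` ?S \<subseteq> relation_colorings (V - {v}) ?E C"
    proof (rule image_subsetI)
      fix \<kappa> assume \<kappa>: "\<kappa> \<in> ?S"
      \<comment> \<open>Merging preserves colors because \<kappa> agrees on \<open>u\<close> and
        \<open>v\<close>.\<close>
      have "restrict \<kappa> (V - {v}) (?f x) = \<kappa> x" if "x \<in> V" for x
        using that \<kappa> assms by auto
      moreover have "\<kappa> x \<noteq> \<kappa> y" if "(x, y) \<in> E" for x y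
        using that \<kappa> by (auto simp: relation_colorings_def)
      ultimately have "restrict \<kappa> (V - {v}) (?f x) \<noteq> restrict \<kappa> (V - {v}) (?f y)"
        if "(x, y) \<in> E" for x y
        using that assms(3) by (metis mem_Sigma_iff subsetD)
      then have "\<forall>(x, y)\<in>?E. restrict \<kappa> (V - {v}) x \<noteq> restrict \<kappa> (V - {v}) y"
        by (simp add: map_prod_def case_prod_beta del: fun_upd_apply restrict_apply)
      moreover have "restrict \<kappa> (V - {v}) \<in> (V - {v}) \<rightarrow>\<^sub>E C"
        using \<kappa> by (auto simp: relation_colorings_def)
      ultimately show "restrict \<kappa> (V - {v}) \<in> relation_colorings (V - {v}) ?E C"
        by (simp only: relation_colorings_def mem_Collect_eq)
    qed
    show "(\<lambda>\<kappa>. \<kappa>(v := \<kappa> u)) ` relation_colorings (V - {v}) ?E C \<subseteq> ?S"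
    proof (rule image_subsetI)
      fix \<kappa> assume \<kappa>: "\<kappa> \<in> relation_colorings (V - {v}) ?E C"
      \<comment> \<open>The extension to \<open>v\<close> is \<kappa> composed with the merging map,
        so it separates \<open>x\<close> and \<open>y\<close> whenever \<kappa> separates their
        images.\<close>
      have "(\<kappa>(v := \<kappa> u)) x = \<kappa> (?f x)" for x by simp
      moreover have "\<kappa> (?f x) \<noteq> \<kappa> (?f y)" if "(x, y) \<in> E" for x y
        using that \<kappa> by (force simp: relation_colorings_def simp del: fun_upd_apply)
      ultimately have "(\<kappa>(v := \<kappa> u)) x \<noteq> (\<kappa>(v := \<kappa> u)) y" if "(x, y) \<in> E" for x y
        using that by metis
      moreover have "\<kappa>(v := \<kappa> u) \<in> V \<rightarrow>\<^sub>E C"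
        using \<kappa> assms by (auto simp: relation_colorings_def PiE_def extensional_def)
      ultimately show "\<kappa>(v := \<kappa> u) \<in> ?S"
        using assms(6) by (auto simp: relation_colorings_def simp del: fun_upd_apply) simp
    qed
  qed
  then have "card ?S = card (relation_colorings (V - {v}) ?E C)"
    by (rule bij_betw_same_card)
  moreover have "relation_colorings V E C = relation_colorings V (insert (u, v) E) C \<union> ?S"
    by (auto simp: relation_colorings_def)
  then have "card (relation_colorings V E C)
      = card (relation_colorings V (insert (u, v) E) C) + card ?S"
    using assms(1,2)
    by (subst card_Un_disjoint[symmetric])
      (auto simp: finite_relation_colorings, auto simp: relation_colorings_def)
  ultimately show ?thesis by simp
qed

text \<open>Deletion and contraction, by induction on the number of ordered pairs. For an undirected
  edge the reverse pair survives deletion of the first and contracts to a loop, which admits no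
  coloring.\<close>

lemma chromatic_polynomial_exists:
  fixes V :: "'a set"
  assumes "finite V" "finite E" "E \<subseteq> V \<times> V"
  shows "\<exists>p :: rat poly. (\<forall>q. poly p (of_nat q) = of_nat (card (relation_colorings V E {..<q :: nat})))
    \<and> (- 1) ^ card V * coeff p 1 \<le> 0"
  using assms
proof (induction "card E" arbitrary: V E rule: less_induct)
  case less
  show ?case
  proof (cases "E = {}")
    case True
    then have "relation_colorings V E {..<q} = V \<rightarrow>\<^sub>E {..<q}" for q :: nat
      by (auto simp: relation_colorings_def)
    \<comment> \<open>Without pairs the count is \<open>q ^ card V\<close>. Its linear coefficient
      is nonzero only for one vertex, where the sign factor is -1.\<close>
    then show ?thesis
      using less.prems(1)
      by (intro exI[of _ "monom 1 (card V)"]) (auto simp: poly_monom card_funcsetE)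
  next
    case False
    then obtain u v where uv: "(u, v) \<in> E" by auto
    show ?thesis
    proof (cases "u = v")
      case True
      with uv have "relation_colorings V E {..<q} = {}" for q :: nat
        by (auto simp: relation_colorings_def)
      then show ?thesis by (intro exI[of _ 0]) simp
    next
      case False
      let ?E = "E - {(u, v)}" and ?f = "id(v := u)"
      let ?F = "map_prod ?f ?f ` ?E"
      have V: "u \<in> V" "v \<in> V" using uv less.prems(3) by auto
      have lt: "card ?E < card E"
        using uv less.prems(2) by (meson card_Diff1_less)
      obtain p :: "rat poly" where
        p: "\<And>q. poly p (of_nat q) = of_nat (card (relation_colorings V ?E {..<q :: nat}))"
          "(- 1) ^ card V * coeff p 1 \<le> 0"
        using less.hyps[OF lt, of V] less.prems by auto
      have "card ?F < card E"
        using lt card_image_le[of ?E "map_prod ?f ?f"] less.prems(2) by simp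
      moreover have "?F \<subseteq> (V - {v}) \<times> (V - {v})"
        using less.prems(3) V False by (auto split: if_splits)
      ultimately obtain r :: "rat poly" where
        r: "\<And>q. poly r (of_nat q) = of_nat (card (relation_colorings (V - {v}) ?F {..<q :: nat}))"
          "(- 1) ^ card (V - {v}) * coeff r 1 \<le> 0"
        using less.hyps[of ?F "V - {v}"] less.prems by auto
      \<comment> \<open>Contraction loses one vertex, which flips the sign condition on
        \<open>r\<close>; this matches the minus sign in \<open>p - r\<close>.\<close>
      have "card V = Suc (card (V - {v}))"
        using V less.prems(1) by (metis card_Suc_Diff1)
      then have "(- 1) ^ card V * coeff (p - r) 1 \<le> 0"
        using p(2) r(2) by (simp add: algebra_simps)
      moreover have "?E \<subseteq> V \<times> V" using less.prems(3) by blast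
      then have "card (relation_colorings V ?E {..<q})
          = card (relation_colorings V E {..<q}) + card (relation_colorings (V - {v}) ?F {..<q})"
        for q :: nat
        using card_relation_colorings_contract[of V "{..<q}" ?E u v] V False less.prems uv
        by (simp add: insert_absorb)
      then have "poly (p - r) (of_nat q) = of_nat (card (relation_colorings V E {..<q}))"
        for q :: nat
        by (simp add: p(1) r(1))
      ultimately show ?thesis by blast
    qed
  qed
qed


section \<open>Specialization to finitely many colors\<close>

definition bounded_monomials :: "nat \<Rightarrow> nat \<Rightarrow> nat multiset set" where
  "bounded_monomials q n = {m. set_mset m \<subseteq> {..<q} \<and> size m = n}"

text \<open>
  The value of the degree \<open>n\<close> part at $x_1 = \dots = x_q = 1$, $x_{q+1} = x_{q+2} = \dots = 0$.
\<close>

definition specialize :: "nat \<Rightarrow> nat \<Rightarrow> mpower_series \<Rightarrow> rat" where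
  "specialize q n F = (\<Sum>m\<in>bounded_monomials q n. mcoeff F m)"

lemma finite_bounded_monomials: "finite (bounded_monomials q n)"
proof (rule finite_subset)
  show "bounded_monomials q n \<subseteq> mset ` {xs. set xs \<subseteq> {..<q} \<and> length xs = n}"
  proof
    fix m assume "m \<in> bounded_monomials q n"
    moreover obtain xs where "m = mset xs" by (metis ex_mset)
    ultimately show "m \<in> mset ` {xs. set xs \<subseteq> {..<q} \<and> length xs = n}"
      by (auto simp: bounded_monomials_def)
  qed
qed (simp add: finite_lists_length_eq)

lemma specialize_elem_sym: "specialize q k (elem_sym k) = of_nat (q choose k)"
proof -
  have "specialize q k (elem_sym k)
      = of_nat (card {m \<in> bounded_monomials q k. \<exists>S. finite S \<and> card S = k \<and> m = mset_set S})"
    unfolding specialize_def mcoeff_elem_sym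
    by (simp add: sum.If_cases[OF finite_bounded_monomials] Int_def)
  also have "{m \<in> bounded_monomials q k. \<exists>S. finite S \<and> card S = k \<and> m = mset_set S}
      = mset_set ` {S. S \<subseteq> {..<q} \<and> card S = k}"
  proof (intro equalityI subsetI)
    fix m assume "m \<in> {m \<in> bounded_monomials q k. \<exists>S. finite S \<and> card S = k \<and> m = mset_set S}"
    then obtain S where "finite S" "card S = k" "m = mset_set S" "set_mset m \<subseteq> {..<q}"
      unfolding bounded_monomials_def by blast
    then show "m \<in> mset_set ` {S. S \<subseteq> {..<q} \<and> card S = k}"
      by (metis (mono_tags, lifting) finite_set_mset_mset_set image_eqI mem_Collect_eq)
  next
    fix m assume "m \<in> mset_set ` {S. S \<subseteq> {..<q} \<and> card S = k}"
    then obtain S where "m = mset_set S" "S \<subseteq> {..<q}" "card S = k" by blast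
    moreover from this have "finite S" by (meson finite_lessThan finite_subset)
    ultimately show "m \<in> {m \<in> bounded_monomials q k. \<exists>S. finite S \<and> card S = k \<and> m = mset_set S}"
      by (auto simp: bounded_monomials_def)
  qed
  also have "card \<dots> = card {S. S \<subseteq> {..<q} \<and> card S = k}"
    by (intro card_image inj_on_inverseI[where g = set_mset] finite_set_mset_mset_set)
      (auto intro: finite_subset[OF _ finite_lessThan])
  also have "\<dots> = q choose k"
    by (simp add: n_subsets)
  finally show ?thesis .
qed

text \<open>As \<open>elem_sym k\<close> is homogeneous of degree \<open>k\<close>, the degree
  \<open>n\<close> part of the product involves only the degree \<open>n - k\<close> part of
  \<open>F\<close>, and evaluation is multiplicative.\<close>

lemma specialize_elem_sym_times:
  "specialize q n (elem_sym k * F)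
    = (if k \<le> n then of_nat (q choose k) * specialize q (n - k) F else 0)"
proof -
  let ?g = "\<lambda>p. mcoeff (elem_sym k) (fst p) * mcoeff F (snd p)"
  let ?U = "\<Union>m\<in>bounded_monomials q n. {(a, b). a + b = m}"
  have size_eq: "size a = k" if "mcoeff (elem_sym k) a \<noteq> 0" for a
    using that by (auto simp: mcoeff_elem_sym split: if_splits)
  have finU: "finite ?U"
    by (simp add: finite_bounded_monomials finite_splittings)
  have U: "specialize q n (elem_sym k * F) = sum ?g ?U"
    unfolding specialize_def mcoeff_times
    by (rule sum.UNION_disjoint[symmetric]) (auto simp: finite_bounded_monomials finite_splittings)
  show ?thesis
  proof (cases "k \<le> n")
    case True
    \<comment> \<open>The splittings whose first component has size \<open>k\<close> form a full
      product of monomial sets; all others contribute 0.\<close>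
    have "sum ?g ?U = sum ?g (bounded_monomials q k \<times> bounded_monomials q (n - k))"
      by (rule sum.mono_neutral_right)
        (use True finU in \<open>auto simp: bounded_monomials_def dest: size_eq\<close>)
    also have "\<dots> = specialize q k (elem_sym k) * specialize q (n - k) F"
      by (simp add: specialize_def sum_product sum.cartesian_product case_prod_beta)
    finally show ?thesis
      using U True by (simp add: specialize_elem_sym)
  next
    case False
    then have "sum ?g ?U = 0"
      using size_eq by (intro sum.neutral) (fastforce simp: bounded_monomials_def)
    with U False show ?thesis by simp
  qed
qed

section \<open>Binomial coefficients as polynomials and their linear terms\<close>

definition binomial_poly :: "nat \<Rightarrow> rat poly" where
  "binomial_poly k = smult (1 / fact k) (\<Prod>i<k. [:- of_nat i, 1:])"

lemma poly_binomial_poly: "poly (binomial_poly k) (of_nat q) = of_nat (q choose k)"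
  by (simp add: binomial_poly_def poly_prod binomial_gbinomial gbinomial_prod_rev atLeast0LessThan)

lemma specialize_elem_sym_part:
  "specialize q n (elem_sym_part lam)
    = (if sum_mset lam = n then poly (\<Prod>k\<in>#lam. binomial_poly k) (of_nat q) else 0)"
proof (induction lam arbitrary: n)
  case empty
  show ?case
    by (simp add: specialize_def elem_sym_part_def mcoeff_one finite_bounded_monomials)
      (auto simp: bounded_monomials_def)
next
  case (add k lam)
  then show ?case
    by (auto simp: elem_sym_part_add_mset specialize_elem_sym_times poly_binomial_poly)
qed

lemma coeff_binomial_poly_0: "0 < k \<Longrightarrow> coeff (binomial_poly k) 0 = 0"
  using poly_binomial_poly[of k 0] by (simp add: poly_0_coeff_0)

lemma coeff_binomial_poly_1:
  assumes "0 < k"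
  shows "(- 1) ^ k * coeff (binomial_poly k) 1 < 0"
proof -
  obtain n where k: "k = Suc n" using assms by (cases k) auto
  \<comment> \<open>The factor for \<open>i = 0\<close> is the variable itself, so the linear
    coefficient is the constant term of the remaining product.\<close>
  have "(\<Prod>i<k. [:- rat_of_nat i, 1:]) = pCons 0 (\<Prod>i<n. [:- rat_of_nat (Suc i), 1:])"
    by (simp add: k prod.lessThan_Suc_shift del: prod.lessThan_Suc of_nat_Suc)
  moreover have "coeff (\<Prod>i<n. [:- rat_of_nat (Suc i), 1:]) 0 = (- 1) ^ n * fact n"
    by (simp add: poly_0_coeff_0[symmetric] poly_prod fact_prod_Suc atLeast0LessThan prod_uminus
        del: of_nat_Suc)
  ultimately have "(- 1) ^ k * coeff (binomial_poly k) 1 = - (fact n / fact k)"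
    by (simp add: binomial_poly_def k flip: power_mult_distrib)
  then show ?thesis by simp
qed

text \<open>With at least two positive parts, two factors have zero constant term, so the product is
  divisible by the square of the variable.\<close>

lemma coeff_prod_binomial_poly_1:
  assumes "int_partition lam" "lam \<noteq> {#}" "\<And>k. lam \<noteq> {#k#}"
  shows "coeff (\<Prod>k\<in>#lam. binomial_poly k) 1 = 0"
proof -
  obtain k mu where lam: "lam = add_mset k mu" using assms(2) by (cases lam) auto
  moreover obtain l nu where mu: "mu = add_mset l nu" using assms(3) lam by (cases mu) auto
  ultimately have "0 < k" "0 < l" using assms(1) by (auto simp: int_partition_def)
  then show ?thesis
    by (simp add: lam mu coeff_mult coeff_binomial_poly_0)
qed

section \<open>Specialization of the chromatic symmetric function and the sign of its one-part
  coefficient\<close>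

lemma mcoeff_chromatic_sym:
  "mcoeff (chromatic_sym G) m
    = of_nat (card {\<kappa> \<in> proper_colorings G. image_mset \<kappa> (mset_set (verts G)) = m})"
  by (simp add: chromatic_sym_def Abs_mpower_series_inverse)

text \<open>A coloring uses only colors below \<open>q\<close> exactly when its monomial is bounded
  by \<open>q\<close>; grouping such colorings by monomial counts each once.\<close>

lemma specialize_chromatic_sym:
  assumes "finite (verts G)"
  shows "specialize q (card (verts G)) (chromatic_sym G)
    = of_nat (card (relation_colorings (verts G) (arcs_ends G) {..<q}))"
proof -
  let ?V = "verts G"
  let ?C = "relation_colorings ?V (arcs_ends G) {..<q}"
  let ?g = "\<lambda>\<kappa>. image_mset \<kappa> (mset_set ?V)"
  have "{\<kappa> \<in> proper_colorings G. ?g \<kappa> = m} = {\<kappa> \<in> ?C. ?g \<kappa> = m}"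
    if "m \<in> bounded_monomials q (card ?V)" for m
    using that assms
    by (auto simp: proper_colorings_def relation_colorings_def bounded_monomials_def PiE_def
        image_subset_iff)
  then have "specialize q (card ?V) (chromatic_sym G)
      = (\<Sum>m\<in>bounded_monomials q (card ?V). \<Sum>\<kappa>\<in>{\<kappa> \<in> ?C. ?g \<kappa> = m}. 1)"
    unfolding specialize_def mcoeff_chromatic_sym by simp
  also have "\<dots> = (\<Sum>\<kappa>\<in>?C. 1)"
  proof (rule sum.group)
    show "?g ` ?C \<subseteq> bounded_monomials q (card ?V)"
      using assms by (auto simp: relation_colorings_def bounded_monomials_def)
  qed (simp_all add: assms finite_relation_colorings finite_bounded_monomials)
  finally show ?thesis by simp
qed

lemma chromatic_sym_expansion_nonneg:
  assumes "graph G" "is_e_expansion c (chromatic_sym G)" "card (verts G) = n" "0 < n"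
  shows "0 \<le> c {#n#}"
proof -
  interpret graph G by fact
  have "arcs_ends G \<subseteq> verts G \<times> verts G"
    by (auto intro: adj_in_verts)
  then obtain p :: "rat poly" where
    p: "\<And>q. poly p (of_nat q) = of_nat (card (relation_colorings (verts G) (arcs_ends G) {..<q :: nat}))"
    and sgn: "(- 1) ^ n * coeff p 1 \<le> 0"
    using chromatic_polynomial_exists[of "verts G" "arcs_ends G"] assms(3)
    by (metis finite_SigmaI finite_subset finite_verts)
  \<comment> \<open>\<open>{#n#}\<close> is inserted so that its term can be isolated even if its
    coefficient is 0.\<close>
  define A where "A = insert {#n#} {lam. c lam \<noteq> 0}"
  have fin: "finite A" using assms(2) by (simp add: A_def is_e_expansion_def)
  have part: "int_partition lam" if "lam \<in> A" for lam
    using that assms(2,4) by (auto simp: A_def is_e_expansion_def int_partition_def)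
  define r where
    "r = (\<Sum>lam\<in>A. if sum_mset lam = n then smult (c lam) (\<Prod>k\<in>#lam. binomial_poly k) else 0)"
  have "mcoeff (chromatic_sym G) m = (\<Sum>lam\<in>A. c lam * mcoeff (elem_sym_part lam) m)" for m
    using assms(2) is_e_expansion_iff[OF fin, of c] by (auto simp: A_def)
  then have "specialize q n (chromatic_sym G) = (\<Sum>lam\<in>A. c lam * specialize q n (elem_sym_part lam))" for q
    unfolding specialize_def by (simp add: sum_distrib_left sum.swap[of _ A])
  then have "specialize q n (chromatic_sym G) = poly r (of_nat q)" for q
    by (auto simp: r_def poly_sum specialize_elem_sym_part intro!: sum.cong)
  then have pr: "poly p (of_nat q) = poly r (of_nat q)" for q
    using p specialize_chromatic_sym[of G q] assms(3) by simp
  \<comment> \<open>Two rational polynomials that agree at all natural numbers are equal.\<close>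
  have "p = r"
  proof (rule ccontr)
    assume "p \<noteq> r"
    then have "finite {x. poly (p - r) x = 0}" by (intro poly_roots_finite) simp
    moreover have "range of_nat \<subseteq> {x. poly (p - r) x = 0}" using pr by auto
    ultimately have "finite (range (of_nat :: nat \<Rightarrow> rat))" using finite_subset by blast
    then show False using finite_imageD[of "of_nat :: nat \<Rightarrow> rat" UNIV] by (simp add: inj_of_nat)
  qed
  have "coeff r 1 = (\<Sum>lam\<in>A. if sum_mset lam = n then c lam * coeff (\<Prod>k\<in>#lam. binomial_poly k) 1 else 0)"
    unfolding r_def coeff_sum by (rule sum.cong) auto
  also have "\<dots> = (\<Sum>lam\<in>{{#n#}}. c lam * coeff (\<Prod>k\<in>#lam. binomial_poly k) 1)"
  proof (rule sum.mono_neutral_cong_right[OF fin])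
    show "\<forall>lam\<in>A - {{#n#}}. (if sum_mset lam = n
        then c lam * coeff (\<Prod>k\<in>#lam. binomial_poly k) 1 else 0) = 0"
    proof
      fix lam assume lam: "lam \<in> A - {{#n#}}"
      have "coeff (\<Prod>k\<in>#lam. binomial_poly k) 1 = 0" if "sum_mset lam = n"
        by (rule coeff_prod_binomial_poly_1) (use that lam part assms(4) in auto)
      then show "(if sum_mset lam = n
          then c lam * coeff (\<Prod>k\<in>#lam. binomial_poly k) 1 else 0) = 0"
        by simp
    qed
  qed (auto simp: A_def)
  finally have "(- 1) ^ n * coeff p 1 = c {#n#} * ((- 1) ^ n * coeff (binomial_poly n) 1)"
    using \<open>p = r\<close> by simp
  \<comment> \<open>A negative \<open>c {#n#}\<close> times the negative second factor would be
    positive, against \<open>sgn\<close>.\<close>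
  with sgn coeff_binomial_poly_1[OF assms(4)] show ?thesis
    by (metis mult_neg_neg not_le)
qed


section \<open>Complete graphs\<close>

text \<open>Proper colorings are the injections, so only squarefree monomials of degree
  \<open>n\<close> occur, each once for every bijection from the vertices to its variables.\<close>

lemma chromatic_sym_complete:
  assumes "K\<^bsub>n\<^esub> K"
  shows "chromatic_sym K = mscale (fact n) (elem_sym n)"
proof (rule mpower_series_eqI)
  fix m
  interpret graph K using assms by (simp add: complete_digraph_def)
  let ?V = "verts K"
  have card: "card ?V = n" and arcs: "arcs_ends K = {(u, v). (u, v) \<in> ?V \<times> ?V \<and> u \<noteq> v}"
    using assms by (simp_all add: complete_digraph_def)
  have proper: "proper_colorings K = {\<kappa> \<in> ?V \<rightarrow>\<^sub>E UNIV. inj_on \<kappa> ?V}"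
    by (auto simp: proper_colorings_def arcs inj_on_def)
  have image: "image_mset \<kappa> (mset_set ?V) = mset_set (\<kappa> ` ?V)" if "inj_on \<kappa> ?V" for \<kappa> :: "'a \<Rightarrow> nat"
    using that by (simp add: image_mset_mset_set)
  show "mcoeff (chromatic_sym K) m = mcoeff (mscale (fact n) (elem_sym n)) m"
  proof (cases "\<exists>S. finite S \<and> card S = n \<and> m = mset_set S")
    case True
    then obtain S where S: "finite S" "card S = n" "m = mset_set S" by blast
    have "{\<kappa> \<in> proper_colorings K. image_mset \<kappa> (mset_set ?V) = m} = {\<kappa> \<in> ?V \<rightarrow>\<^sub>E S. inj_on \<kappa> ?V}"
    proof (intro equalityI subsetI)
      fix \<kappa> assume "\<kappa> \<in> {\<kappa> \<in> proper_colorings K. image_mset \<kappa> (mset_set ?V) = m}"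
      then have \<kappa>: "\<kappa> \<in> ?V \<rightarrow>\<^sub>E UNIV" "inj_on \<kappa> ?V" "mset_set (\<kappa> ` ?V) = mset_set S"
        using image S by (auto simp: proper)
      then have "\<kappa> ` ?V = S" using S(1) by (simp add: mset_set_eq_iff)
      with \<kappa> show "\<kappa> \<in> {\<kappa> \<in> ?V \<rightarrow>\<^sub>E S. inj_on \<kappa> ?V}" by auto
    next
      fix \<kappa> assume \<kappa>: "\<kappa> \<in> {\<kappa> \<in> ?V \<rightarrow>\<^sub>E S. inj_on \<kappa> ?V}"
      \<comment> \<open>An injection between finite sets of equal size is onto.\<close>
      then have "\<kappa> ` ?V = S"
        using S card by (intro card_subset_eq) (auto simp: card_image)
      with \<kappa> show "\<kappa> \<in> {\<kappa> \<in> proper_colorings K. image_mset \<kappa> (mset_set ?V) = m}"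
        using image S by (auto simp: proper PiE_def)
    qed
    moreover have "card {\<kappa> \<in> ?V \<rightarrow>\<^sub>E S. inj_on \<kappa> ?V} = fact n"
      using card_inj_on_subset_funcset[of ?V S ?V] S card by (simp add: fact_prod_rev)
    ultimately show ?thesis
      using True by (simp add: mcoeff_chromatic_sym mcoeff_mscale mcoeff_elem_sym)
  next
    case False
    then have "{\<kappa> \<in> proper_colorings K. image_mset \<kappa> (mset_set ?V) = m} = {}"
      using image card card_image by (fastforce simp: proper)
    moreover have "mcoeff (elem_sym n) m = 0"
      unfolding mcoeff_elem_sym if_not_P[OF False] ..
    ultimately show ?thesis
      unfolding mcoeff_chromatic_sym mcoeff_mscale by (metis card.empty mult_zero_right of_nat_0)
  qed
qed

text \<open>The coefficient of \<open>elem_sym n\<close> in the series of \<open>K\<close> is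
  \<open>fact n\<close>, which cancels against the scalar in that series.\<close>

lemma X_e_complete:
  assumes "card (verts G) = n" "0 < n" "K\<^bsub>n\<^esub> K"
  shows "X_e G K = chromatic_sym G
    - mscale (e_coeff {#n#} (chromatic_sym G)) (elem_sym_part {#n#})"
proof -
  have "is_e_expansion (\<lambda>lam. if lam = {#n#} then fact n else 0) (chromatic_sym K)"
    using assms by (subst is_e_expansion_iff[of "{{#n#}}"])
      (auto simp: chromatic_sym_complete mcoeff_mscale elem_sym_part_def int_partition_def)
  then have "e_coeff {#n#} (chromatic_sym K) = fact n"
    by (simp add: e_coeff_eqI)
  then show ?thesis
    using assms
    by (auto simp: X_e_def chromatic_sym_complete elem_sym_part_def mcoeff_minus mcoeff_mscale
        intro!: mpower_series_eqI)
qed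

theorem theorem2p21:
  fixes n :: nat
    and G :: "('a, 'b) pre_digraph"
    and K :: "('c, 'd) pre_digraph"
  assumes "n \<ge> 1"
    and "graph G" and "connected G" and "card (verts G) = n"
    and "K\<^bsub>n\<^esub> K"
  shows "G \<ge>\<^sub>e K \<longleftrightarrow> e_positive (chromatic_sym G)"
proof -
  let ?X = "chromatic_sym G" and ?e = "elem_sym_part {#n#}"
  have part: "int_partition {#n#}" using assms(1) by (simp add: int_partition_def)
  have X: "X_e G K = ?X - mscale (e_coeff {#n#} ?X) ?e"
    using assms by (simp add: X_e_complete)
  show ?thesis
  proof (cases "\<exists>c. is_e_expansion c ?X")
    case True
    then obtain c where c: "is_e_expansion c ?X" by blast
    \<comment> \<open>Passing to \<open>X_e G K\<close> only replaces the coefficient at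
      \<open>{#n#}\<close> by 0. The replaced value is nonnegative, so positivity is equivalent for
      the two series.\<close>
    have "is_e_expansion (c({#n#} := 0)) (X_e G K)"
      using is_e_expansion_diff[OF c part, of "c {#n#}"] X c by (simp add: e_coeff_eqI)
    moreover have "0 \<le> c {#n#}"
      using chromatic_sym_expansion_nonneg[OF assms(2) c assms(4)] assms(1) by simp
    ultimately show ?thesis
      unfolding geq_e_def e_positive_def e_coeff_eqI[OF c]
      by (simp add: e_coeff_eqI) metis
  next
    case False
    \<comment> \<open>Both descriptions are empty, so \<open>THE\<close> returns the same junk value for both series;
      thus the existence of elementary expansions is never needed.\<close>
    have "\<not> is_e_expansion c (X_e G K)" for c
    proof
      assume "is_e_expansion c (X_e G K)"
      \<comment> \<open>The negated scalar adds the removed term back.\<close>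
      from is_e_expansion_diff[OF this part, of "- e_coeff {#n#} ?X"]
      have "\<exists>c. is_e_expansion c (X_e G K - mscale (- e_coeff {#n#} ?X) ?e)" by blast
      also have "X_e G K - mscale (- e_coeff {#n#} ?X) ?e = ?X"
        by (rule mpower_series_eqI) (simp add: X mcoeff_minus mcoeff_mscale)
      finally show False using False by blast
    qed
    with False have "is_e_expansion c (X_e G K) = is_e_expansion c ?X" for c by blast
    then show ?thesis by (simp add: geq_e_def e_positive_def e_coeff_def)
  qed
qed

end
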